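(* Let $m\ge 4$ be an integer with $m\equiv 0\pmod 4$, and let $e=\frac{3^m-1}{2}+3^{\frac{m}{2}}+1$. Then $\mathcal{C}_{(0,1,e)}$ is an optimal ternary cyclic code with parameters $[3^m-1,\ 3^m-\frac{3m}{2}-2,\ 4]$.
   Context: Let $m$ be a positive integer, $\mathbb{F}_{3^m}$ the finite field with $3^m$ elements, and $\alpha$ a generator of the multiplicative group $\mathbb{F}_{3^m}^*$. For an integer $i$, $m_{\alpha^i}(x)$ denotes the minimal polynomial of $\alpha^i$ over $\mathbb{F}_3$. An $[n,k,d]$ linear code over $\mathbb{F}_3$ is a $k$-dimensional subspace of $\mathbb{F}_3^n$ with minimum Hamming distance $d$. A ternary cyclic code of length $n$ (with $\gcd(n,3)=1$) is identified with an ideal of $\mathbb{F}_3[x]/(x^n-1)$ via $(c_0,\dots,c_{n-1})\mapsto c_0+c_1x+\cdots+c_{n-1}x^{n-1}$; its generator polynomial is the monic polynomial of least degree generating the ideal. $\mathcal{C}_{(i_1,i_2,\dots,i_t)}$ denotes the ternary cyclic code of length $3^m-1$ with generator polynomial $m_{\alpha^{i_1}}(x)m_{\alpha^{i_2}}(x)\cdots m_{\alpha^{i_t}}(x)$. A ternary $[n,k,d]$ code is optimal (in the standard sense) if no linear code over $\mathbb{F}_3$ of length $n$ and dimension $k$ has minimum distance larger than $d$. *)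

theory Defs
  imports
    "Berlekamp_Zassenhaus.Finite_Field"
    "Jordan_Normal_Form.VS_Connect"
    "HOL-Algebra.QuotRing"
begin

section \<open>Linear codes\<close>

definition hamming_dist :: "'f vec \<Rightarrow> 'f vec \<Rightarrow> nat" where
  "hamming_dist u v = card {i. i < dim_vec u \<and> u $ i \<noteq> v $ i}"

text \<open>For a code with at most one word, \<^term>\<open>min_distance\<close> is an unspecified number.\<close>

definition min_distance :: "'f vec set \<Rightarrow> nat" where
  "min_distance C = Min {hamming_dist u v | u v. u \<in> C \<and> v \<in> C \<and> u \<noteq> v}"

definition linear_code :: "nat \<Rightarrow> nat \<Rightarrow> nat \<Rightarrow> 'f::field vec set \<Rightarrow> bool" where
  "linear_code n k d C \<longleftrightarrow>
     VectorSpace.subspace class_ring C (module_vec TYPE('f) n) \<and>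
     vectorspace.dim class_ring (module_vec TYPE('f) n \<lparr>carrier := C\<rparr>) = k \<and>
     min_distance C = d"

definition optimal_code :: "nat \<Rightarrow> nat \<Rightarrow> nat \<Rightarrow> 'f::field vec set \<Rightarrow> bool" where
  "optimal_code n k d C \<longleftrightarrow>
     linear_code n k d C \<and> \<not> (\<exists>(C' :: 'f vec set) d'. linear_code n k d' C' \<and> d < d')"


section \<open>Cyclic codes\<close>

definition cyclic_ideal :: "nat \<Rightarrow> 'f::field poly set" where
  "cyclic_ideal n = PIdl\<^bsub>class_ring\<^esub> (monom 1 n - 1)"

definition cyclic_ring :: "nat \<Rightarrow> 'f::field poly set ring" where
  "cyclic_ring n = class_ring Quot (cyclic_ideal n)"

definition cyclic_class :: "nat \<Rightarrow> 'f::field poly \<Rightarrow> 'f poly set" where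
  "cyclic_class n p = cyclic_ideal n +>\<^bsub>class_ring\<^esub> p"

definition code_ideal :: "nat \<Rightarrow> 'f::field vec set \<Rightarrow> 'f poly set set" where
  "code_ideal n C = (\<lambda>c. cyclic_class n (Poly (list_of_vec c))) ` C"

definition cyclic_code :: "nat \<Rightarrow> 'f::field vec set \<Rightarrow> bool" where
  "cyclic_code n C \<longleftrightarrow> C \<subseteq> carrier_vec n \<and> ideal (code_ideal n C) (cyclic_ring n)"

definition generates_code :: "nat \<Rightarrow> 'f::field vec set \<Rightarrow> 'f poly \<Rightarrow> bool" where
  "generates_code n C g \<longleftrightarrow> Idl\<^bsub>cyclic_ring n\<^esub> {cyclic_class n g} = code_ideal n C"

definition is_generator_poly :: "nat \<Rightarrow> 'f::field vec set \<Rightarrow> 'f poly \<Rightarrow> bool" where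
  "is_generator_poly n C g \<longleftrightarrow>
     monic g \<and> generates_code n C g \<and>
     (\<forall>h. monic h \<and> generates_code n C h \<longrightarrow> degree g \<le> degree h)"

text \<open>The ideal generated by the class of \<open>g\<close> determines the code, so at most one code is described.
  One exists only if \<open>g\<close> is a monic divisor of \<open>x^n - 1\<close>.\<close>

definition cyclic_code_of :: "nat \<Rightarrow> 'f::field poly \<Rightarrow> 'f vec set" where
  "cyclic_code_of n g = (THE C. cyclic_code n C \<and> is_generator_poly n C g)"


section \<open>Ternary cyclic codes from minimal polynomials\<close>

instance Enum.finite_3 :: prime_card
  by standard (simp add: UNIV_finite_3 flip: numeral_3_eq_3)

type_synonym F3 = "Enum.finite_3 mod_ring"

text \<open>This is the inclusion of the prime field when the codomain has characteristic 3.\<close>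

definition F3_embed :: "F3 \<Rightarrow> 'a::field" where
  "F3_embed c = of_int (to_int_mod_ring c)"

definition F3_root :: "F3 poly \<Rightarrow> 'a::field \<Rightarrow> bool" where
  "F3_root p b \<longleftrightarrow> poly (map_poly F3_embed p) b = 0"

definition min_poly :: "'a::field \<Rightarrow> F3 poly" where
  "min_poly b = (THE p. monic p \<and> F3_root p b \<and>
                        (\<forall>q. q \<noteq> 0 \<and> F3_root q b \<longrightarrow> degree p \<le> degree q))"

definition mult_generator :: "'a::field \<Rightarrow> bool" where
  "mult_generator a \<longleftrightarrow> range (\<lambda>i::int. a powi i) = UNIV - {0}"

definition ternary_code :: "nat \<Rightarrow> 'a::field \<Rightarrow> int list \<Rightarrow> F3 vec set" where
  "ternary_code m a ks = cyclic_code_of (3 ^ m - 1) (\<Prod>i\<leftarrow>ks. min_poly (a powi i))"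

end

theory Submission
  imports Defs "Berlekamp_Zassenhaus.Distinct_Degree_Factorization"
begin

text \<open>Write \<open>m = 2h\<close>, \<open>r = 3^h\<close> and \<open>\<chi>(x) = x^((r^2-1)/2)\<close>, so that \<open>x^e = \<chi>(x) x^(r+1)\<close> is the norm of
  \<open>x\<close> to the field with \<open>r\<close> elements, up to the sign \<open>\<chi>(x)\<close>. Because of the root 1, a word of weight 3 has
  equal coefficients, so after scaling it gives \<open>u + v + 1 = 0\<close> and \<open>u^e + v^e + 1 = 0\<close>. If \<open>\<chi>(u) = \<chi>(v) = 1\<close>,
  the second equation says that \<open>u - 1\<close> has norm 0. For the other signs it says that \<open>u\<close>, \<open>v\<close> or
  \<open>v/u\<close> has trace 0 over the subfield, which forces \<open>\<chi> = -1\<close> there and contradicts the signs.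
  The minimal polynomials have degrees 1, \<open>2h\<close> and \<open>h\<close>, since \<open>\<alpha>^e = -\<alpha>^(r+1)\<close> generates the subfield.
  Optimality is a packing argument: a code of distance at least 5 with this redundancy would need
  \<open>n choose 2 \<le> 3^(3h+1)\<close>.\<close>

section \<open>Cardinality, distance and packing\<close>

text \<open>Coordinates with respect to a finite basis match the vectors with the coefficient
  functions on that basis. Dimensions of codes can therefore be found by counting words.\<close>

lemma card_carrier_eq_power_dim:
  assumes "vectorspace K V" and "finite (carrier V)"
  shows "card (carrier V) = card (carrier K) ^ vectorspace.dim K V"
proof -
  interpret vectorspace K V by fact
  have "gen_set (carrier V)"
    using span_is_subset2[OF order_refl] in_own_span[OF order_refl] by blast
  then have "fin_dim"
    unfolding fin_dim_def using assms(2) by blast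
  then obtain B where B: "finite B" "basis B"
    using finite_basis_exists by blast
  then have sub: "B \<subseteq> carrier V"
    by (simp add: basis_def)
  have ex1: "\<exists>!a. a \<in> B \<rightarrow>\<^sub>E carrier K \<and> lincomb a B = v" if "v \<in> carrier V" for v
    using basis_criterion[OF B(1) sub] B(2) that by blast
  have "bij_betw (\<lambda>a. lincomb a B) (B \<rightarrow>\<^sub>E carrier K) (carrier V)"
    unfolding bij_betw_def inj_on_def
  proof (intro conjI ballI impI equalityI subsetI)
    have closed: "lincomb a B \<in> carrier V" if "a \<in> B \<rightarrow>\<^sub>E carrier K" for a
      using that sub by (intro lincomb_closed) auto
    fix a b assume "a \<in> B \<rightarrow>\<^sub>E carrier K" "b \<in> B \<rightarrow>\<^sub>E carrier K" "lincomb a B = lincomb b B"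
    then show "a = b" using ex1[OF closed] by blast
  next
    fix v assume "v \<in> (\<lambda>a. lincomb a B) ` (B \<rightarrow>\<^sub>E carrier K)"
    then show "v \<in> carrier V" using sub by (auto intro!: lincomb_closed)
  next
    fix v assume "v \<in> carrier V"
    then show "v \<in> (\<lambda>a. lincomb a B) ` (B \<rightarrow>\<^sub>E carrier K)" using ex1 by blast
  qed
  then have "card (carrier V) = card (B \<rightarrow>\<^sub>E carrier K)"
    by (simp add: bij_betw_same_card)
  also have "\<dots> = card (carrier K) ^ card B"
    using B(1) by (simp add: card_funcsetE)
  finally show ?thesis
    using dim_basis[OF B] by simp
qed

lemma finite_carrier_vec: "finite (carrier_vec n :: 'f::finite vec set)"
  using card_carrier_vec[of n, where 'b='f] zero_less_card_finite by (metis card_ge_0_finite zero_less_power)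

lemma subspace_code_iff:
  "VectorSpace.subspace class_ring C (module_vec TYPE('f::field) n) \<longleftrightarrow>
     C \<subseteq> carrier_vec n \<and> 0\<^sub>v n \<in> C \<and> (\<forall>u\<in>C. \<forall>v\<in>C. u + v \<in> C) \<and> (\<forall>a. \<forall>v\<in>C. a \<cdot>\<^sub>v v \<in> C)"
proof -
  interpret vec_space "TYPE('f)" n .
  have "submodule class_ring C V \<longleftrightarrow> C \<subseteq> carrier_vec n \<and> 0\<^sub>v n \<in> C \<and> (\<forall>u\<in>C. \<forall>v\<in>C. u + v \<in> C)
    \<and> (\<forall>a. \<forall>v\<in>C. a \<cdot>\<^sub>v v \<in> C)"
    unfolding submodule_def using module_axioms by (auto simp: module_vec_simps)
  then show ?thesis
    unfolding subspace_def using vectorspace_axioms by blast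
qed

lemma card_subspace_code:
  fixes C :: "'f::{field,finite} vec set"
  assumes "VectorSpace.subspace class_ring C (module_vec TYPE('f) n)"
  shows "card C = CARD('f) ^ vectorspace.dim class_ring (module_vec TYPE('f) n \<lparr>carrier := C\<rparr>)"
proof -
  interpret vec_space "TYPE('f)" n .
  have "vectorspace class_ring (vs C)"
    using subspace_is_vs assms by blast
  moreover have "finite C"
    using assms subspace_code_iff finite_carrier_vec finite_subset by metis
  ultimately show ?thesis
    using card_carrier_eq_power_dim[of class_ring "vs C"] by simp
qed

lemma finite_hamming_dists:
  assumes "finite C"
  shows "finite {hamming_dist u v | u v. u \<in> C \<and> v \<in> C \<and> u \<noteq> v}"
proof -
  have "{hamming_dist u v | u v. u \<in> C \<and> v \<in> C \<and> u \<noteq> v} \<subseteq> (\<lambda>(u,v). hamming_dist u v) ` (C \<times> C)"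
    by auto
  then show ?thesis using assms finite_subset by blast
qed

lemma min_distance_le:
  assumes "finite C" "u \<in> C" "v \<in> C" "u \<noteq> v"
  shows "min_distance C \<le> hamming_dist u v"
  unfolding min_distance_def using assms finite_hamming_dists[OF assms(1)] by (intro Min_le) auto

text \<open>\<open>Min\<close> is unspecified on the empty set, so two distinct words are needed to
  supply at least one distance.\<close>

lemma min_distance_ge:
  assumes "finite C" "card C > 1" "\<And>u v. u \<in> C \<Longrightarrow> v \<in> C \<Longrightarrow> u \<noteq> v \<Longrightarrow> d \<le> hamming_dist u v"
  shows "d \<le> min_distance C"
proof -
  obtain u v where "u \<in> C" "v \<in> C" "u \<noteq> v"
    using assms(2) by (metis One_nat_def card_1_singleton_iff card_le_Suc0_iff_eq card_gt_0_iff assms(1) not_less)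
  then have "{hamming_dist u v | u v. u \<in> C \<and> v \<in> C \<and> u \<noteq> v} \<noteq> {}" by auto
  then show ?thesis
    unfolding min_distance_def using assms(3) finite_hamming_dists[OF assms(1)] by (subst Min_ge_iff) auto
qed

section \<open>The packing bound and the optimality criterion\<close>

definition indicator_vec :: "nat \<Rightarrow> nat set \<Rightarrow> 'f::zero_neq_one vec" where
  "indicator_vec n S = vec n (\<lambda>i. if i \<in> S then 1 else 0)"

text \<open>The translates of the code by the vectors with exactly two entries 1 are disjoint. This weak form
  of the sphere packing bound suffices for the parameters at hand.\<close>
lemma card_code_mult_choose_2_le:
  fixes C :: "'f::{field,finite} vec set"
  assumes C: "C \<subseteq> carrier_vec n" and d: "min_distance C > 4"
  shows "card C * (n choose 2) \<le> CARD('f) ^ n"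
proof -
  let ?S = "{S. S \<subseteq> {..<n} \<and> card S = 2}"
  let ?f = "\<lambda>(c, S). c + (indicator_vec n S :: 'f vec)"
  have finC: "finite C" using C finite_carrier_vec finite_subset by blast
  have inj: "inj_on ?f (C \<times> ?S)"
  proof (rule inj_onI, clarify)
    fix c S c' S'
    assume c: "c \<in> C" "c' \<in> C" and S: "S \<subseteq> {..<n}" "card S = 2" "S' \<subseteq> {..<n}" "card S' = 2"
      and eq: "c + indicator_vec n S = c' + (indicator_vec n S' :: 'f vec)"
    have dim: "dim_vec c = n" "dim_vec c' = n" using c C by auto
    have nth: "c $ i + (if i \<in> S then 1 else 0) = c' $ i + (if i \<in> S' then 1 else 0)" if "i < n" for i
      using arg_cong[OF eq, of "\<lambda>v. v $ i"] that dim by (simp add: indicator_vec_def)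
    have "c = c'"
    proof (rule ccontr)
      assume "c \<noteq> c'"
      \<comment> \<open>Outside \<open>S \<union> S'\<close> both summands added are 0, so there the
        words agree. Two pairs cover at most 4 positions.\<close>
      have "{i. i < dim_vec c \<and> c $ i \<noteq> c' $ i} \<subseteq> S \<union> S'"
        using nth dim by (fastforce split: if_splits)
      then have "hamming_dist c c' \<le> card (S \<union> S')"
        unfolding hamming_dist_def using S by (intro card_mono) (auto intro: finite_subset)
      also have "\<dots> \<le> 4" using card_Un_le[of S S'] S by simp
      finally show False using min_distance_le[OF finC c \<open>c \<noteq> c'\<close>] d by simp
    qed
    moreover have "i \<in> S \<longleftrightarrow> i \<in> S'" if "i < n" for i
      using nth[OF that] \<open>c = c'\<close> by (auto split: if_splits)
    ultimately show "c = c' \<and> S = S'" using S by blast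
  qed
  have "card (C \<times> ?S) \<le> card (carrier_vec n :: 'f vec set)"
    using C inj finite_carrier_vec by (intro card_inj_on_le[of ?f]) (auto simp: indicator_vec_def)
  then show ?thesis
    by (simp add: card_cartesian_product n_subsets card_carrier_vec)
qed

lemma linear_code_dist_le_4:
  fixes C :: "'f::{field,finite} vec set"
  assumes "linear_code n k d C" and "CARD('f) ^ n < CARD('f) ^ k * (n choose 2)"
  shows "d \<le> 4"
proof (rule ccontr)
  assume "\<not> d \<le> 4"
  then show False
    using assms card_code_mult_choose_2_le[of C n] card_subspace_code[of C n] subspace_code_iff[of C n]
    by (auto simp: linear_code_def)
qed

text \<open>The last hypothesis does double duty: it caps the minimum distance of \<open>C\<close>
  itself at 4, which with the lower bound makes it exactly 4, and it caps that of every competitor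
  of the same length and dimension.\<close>

lemma optimal_codeI:
  fixes C :: "'f::{field,finite} vec set"
  assumes sub: "VectorSpace.subspace class_ring C (module_vec TYPE('f) n)"
    and card: "card C = CARD('f) ^ k" and "k > 0"
    and dist: "\<And>u v. u \<in> C \<Longrightarrow> v \<in> C \<Longrightarrow> u \<noteq> v \<Longrightarrow> 4 \<le> hamming_dist u v"
    and bound: "CARD('f) ^ n < CARD('f) ^ k * (n choose 2)"
  shows "optimal_code n k 4 C"
proof -
  have "CARD('f) > 1" 
    using card_2_iff' [of "{0,1::'f}"] card_mono[of UNIV "{0,1::'f}"] by simp
  have "CARD('f) ^ k > 1"
    using \<open>k > 0\<close> \<open>CARD('f) > 1\<close> by (rule one_less_power[rotated])
  then have "4 \<le> min_distance C"
    using card sub by (intro min_distance_ge dist) (auto intro: card_ge_0_finite)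
  moreover have dim: "vectorspace.dim class_ring (module_vec TYPE('f) n \<lparr>carrier := C\<rparr>) = k"
    using card_subspace_code[OF sub] card \<open>CARD('f) > 1\<close> by simp
  then have "linear_code n k (min_distance C) C"
    using sub by (simp add: linear_code_def)
  then have "min_distance C \<le> 4"
    using linear_code_dist_le_4 bound by blast
  ultimately have "min_distance C = 4" by simp
  then show ?thesis
    unfolding optimal_code_def using sub dim bound linear_code_dist_le_4[where 'f='f]
    by (auto simp: linear_code_def[of n k 4] not_less dest!: leD)
qed

section \<open>Cyclic codes as sets of multiples\<close>

definition word_poly :: "'f::zero vec \<Rightarrow> 'f poly" where
  "word_poly v = Poly (list_of_vec v)"

lemma coeff_word_poly: "coeff (word_poly v) i = (if i < dim_vec v then v $ i else 0)"
  by (auto simp: word_poly_def nth_default_def list_of_vec_index length_list_of_vec)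

text \<open>Bounding coefficients instead of the degree keeps this right for \<open>k = 0\<close>,
  where the zero polynomial must remain although no degree is below 0.\<close>

lemma bij_betw_word_poly:
  "bij_betw word_poly (carrier_vec k) {p :: 'f::zero poly. \<forall>i\<ge>k. coeff p i = 0}"
proof (rule bij_betwI[where g = "\<lambda>p. vec k (coeff p)"])
  show "word_poly \<in> carrier_vec k \<rightarrow> {p. \<forall>i\<ge>k. coeff p i = 0}"
    by (auto simp: coeff_word_poly)
qed (auto simp: coeff_word_poly intro!: eq_vecI poly_eqI)

lemma card_polys_coeff_bounded: "card {p :: 'f::{field,finite} poly. \<forall>i\<ge>k. coeff p i = 0} = CARD('f) ^ k"
  using bij_betw_same_card[OF bij_betw_word_poly[of k, where 'f = 'f]] by (simp add: card_carrier_vec)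

lemma degree_less_iff_coeff:
  fixes p :: "'f::zero poly"
  assumes "k > 0"
  shows "degree p < k \<longleftrightarrow> (\<forall>i\<ge>k. coeff p i = 0)"
  using assms by (metis coeff_eq_0 degree_0 leading_coeff_neq_0 linorder_not_le order_less_le_trans)

lemma coeff_bounded_iff:
  fixes p :: "'f::zero poly"
  shows "(\<forall>i\<ge>k. coeff p i = 0) \<longleftrightarrow> p = 0 \<or> degree p < k"
  by (metis coeff_0 coeff_eq_0 leading_coeff_0_iff linorder_not_le order_less_le_trans)

text \<open>An explicit set to replace the \<open>THE\<close> in \<open>cyclic_code_of\<close>. The
  two agree for positive \<open>n\<close> when \<open>g\<close> is a monic divisor of
  \<open>x^n - 1\<close>.\<close>

definition multiples_code :: "nat \<Rightarrow> 'f::field poly \<Rightarrow> 'f vec set" where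
  "multiples_code n g = {v \<in> carrier_vec n. g dvd word_poly v}"

lemma subspace_multiples_code:
  "VectorSpace.subspace class_ring (multiples_code n g) (module_vec TYPE('f::field) n)"
proof -
  have "word_poly (0\<^sub>v n) = (0 :: 'f poly)"
    by (rule poly_eqI) (simp add: coeff_word_poly)
  moreover have "word_poly (u + v) = word_poly u + word_poly v"
    if "u \<in> carrier_vec n" "v \<in> carrier_vec n" for u v :: "'f vec"
    using that by (intro poly_eqI) (simp add: coeff_word_poly)
  moreover have "word_poly (a \<cdot>\<^sub>v v) = smult a (word_poly v)" for a and v :: "'f vec"
    by (intro poly_eqI) (simp add: coeff_word_poly)
  ultimately show ?thesis
    by (auto simp: subspace_code_iff multiples_code_def dvd_smult)
qed

text \<open>Division by \<open>g\<close> turns words into polynomials with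
  \<open>n - degree g\<close> free coefficients.\<close>

lemma card_multiples_code:
  fixes g :: "'f::{field,finite} poly"
  assumes "g \<noteq> 0" and "degree g \<le> n"
  shows "card (multiples_code n g) = CARD('f) ^ (n - degree g)"
proof -
  let ?P = "\<lambda>k. {p :: 'f poly. \<forall>i\<ge>k. coeff p i = 0}"
  have 1: "bij_betw word_poly (multiples_code n g) {p \<in> ?P n. g dvd p}"
    using bij_betw_word_poly[of n, where 'f = 'f]
    by (auto simp: multiples_code_def bij_betw_def inj_on_def)
  have "g * p \<in> ?P n \<longleftrightarrow> p \<in> ?P (n - degree g)" for p
    using assms by (cases "p = 0") (auto simp: coeff_bounded_iff degree_mult_eq)
  then have 2: "bij_betw (\<lambda>p. g * p) (?P (n - degree g)) {p \<in> ?P n. g dvd p}"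
    using assms(1) by (intro bij_betwI[where g = "\<lambda>p. p div g"]) auto
  show ?thesis
    using bij_betw_same_card[OF 1] bij_betw_same_card[OF 2] by (simp add: card_polys_coeff_bounded)
qed

section \<open>The quotient ring and the ideal of a cyclic code\<close>

context
  fixes n :: nat
  assumes "SORT_CONSTRAINT('f::field)"
begin

lemma in_cyclic_ideal_iff: "(p :: 'f poly) \<in> cyclic_ideal n \<longleftrightarrow> monom 1 n - 1 dvd p"
  by (auto simp: cyclic_ideal_def cgenideal_def dvd_def mult.commute)

lemma ideal_cyclic_ideal: "ideal (cyclic_ideal n :: 'f poly set) class_ring"
  unfolding cyclic_ideal_def by (rule cring.cgenideal_ideal[OF class_cring.cring_axioms]) simp

lemma cring_cyclic_ring: "cring (cyclic_ring n :: 'f poly set ring)"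
  unfolding cyclic_ring_def
  by (rule ideal.quotient_is_cring[OF ideal_cyclic_ideal]) (rule class_cring.cring_axioms)

lemma cyclic_class_hom: "cyclic_class n \<in> Ring.ring_hom class_ring (cyclic_ring n :: 'f poly set ring)"
  using ideal.rcos_ring_hom[OF ideal_cyclic_ideal]
  by (simp add: cyclic_class_def[abs_def] cyclic_ring_def)

lemma cyclic_class_mult:
  "cyclic_class n p \<otimes>\<^bsub>cyclic_ring n\<^esub> cyclic_class n q = cyclic_class n (p * q :: 'f poly)"
  using ring_hom_mult[OF cyclic_class_hom, of p q] by simp

lemma carrier_cyclic_ring: "carrier (cyclic_ring n) = range (cyclic_class n :: 'f poly \<Rightarrow> _)"
  by (auto simp: cyclic_ring_def FactRing_def A_RCOSETS_def' cyclic_class_def[abs_def])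

lemma cyclic_class_eq_iff:
  "cyclic_class n p = cyclic_class n (q :: 'f poly) \<longleftrightarrow> monom 1 n - 1 dvd p - q"
proof -
  have "r \<in> cyclic_class n p \<longleftrightarrow> monom 1 n - 1 dvd r - p" for r p :: "'f poly"
  proof -
    have "r \<in> cyclic_class n p \<longleftrightarrow> (\<exists>h\<in>cyclic_ideal n. r = h + p)"
      by (auto simp: cyclic_class_def a_r_coset_def')
    also have "\<dots> \<longleftrightarrow> r - p \<in> cyclic_ideal n"
      by (metis add_diff_cancel diff_add_cancel)
    finally show ?thesis by (simp add: in_cyclic_ideal_iff)
  qed
  note mem = this
  show ?thesis
  proof
    assume "cyclic_class n p = cyclic_class n q"
    then have "p \<in> cyclic_class n q" using mem[of p p] by simp
    then show "monom 1 n - 1 dvd p - q" by (simp add: mem)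
  next
    assume *: "monom 1 n - 1 dvd p - q"
    have "monom 1 n - 1 dvd r - p \<longleftrightarrow> monom 1 n - 1 dvd r - q" for r
      using dvd_add_left_iff[OF *, of "r - p"] by (simp add: algebra_simps)
    then show "cyclic_class n p = cyclic_class n q" using mem by blast
  qed
qed

context
  assumes n: "n > 0"
begin

lemma monom_minus_one: "monom 1 n - 1 \<noteq> (0 :: 'f poly)" "degree (monom 1 n - 1 :: 'f poly) = n"
proof -
  show deg: "degree (monom 1 n - 1 :: 'f poly) = n"
    using degree_add_eq_left[of "- 1" "monom 1 n :: 'f poly"] n by (simp add: degree_monom_eq)
  show "monom 1 n - 1 \<noteq> (0 :: 'f poly)" using deg n by force
qed

text \<open>The difference of two word polynomials has degree below \<open>n\<close>, so
  \<open>x^n - 1\<close> divides it only if it is 0.\<close>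

lemma inj_on_cyclic_class: "inj_on (\<lambda>c. cyclic_class n (Poly (list_of_vec c))) (carrier_vec n :: 'f vec set)"
proof (rule inj_onI)
  fix u v :: "'f vec"
  assume uv: "u \<in> carrier_vec n" "v \<in> carrier_vec n"
    and "cyclic_class n (Poly (list_of_vec u)) = cyclic_class n (Poly (list_of_vec v))"
  then have "monom 1 n - 1 dvd word_poly u - word_poly v"
    by (simp add: cyclic_class_eq_iff word_poly_def)
  moreover have "degree (word_poly u - word_poly v) < n"
    using uv n by (simp add: degree_less_iff_coeff coeff_word_poly)
  ultimately have "word_poly u - word_poly v = 0"
    using dvd_imp_degree_le[of "monom 1 n - 1" "word_poly u - word_poly v"] monom_minus_one(2) by fastforce
  then show "u = v"
    using bij_betw_word_poly[of n, where 'f='f] uv by (auto simp: bij_betw_def inj_on_def)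
qed

context
  fixes g :: "'f poly"
  assumes g: "g dvd monom 1 n - 1"
begin

text \<open>Since \<open>g\<close> divides \<open>x^n - 1\<close>, reduction modulo
  \<open>x^n - 1\<close> preserves divisibility by \<open>g\<close>. Hence the class of any multiple
  of \<open>g\<close> is already the class of a word of the code.\<close>

lemma code_ideal_multiples_code:
  "code_ideal n (multiples_code n g) = cyclic_class n ` {p. g dvd p}"
proof (intro equalityI subsetI)
  fix x assume "x \<in> code_ideal n (multiples_code n g)"
  then show "x \<in> cyclic_class n ` {p. g dvd p}"
    by (auto simp: code_ideal_def multiples_code_def word_poly_def)
next
  fix x assume "x \<in> cyclic_class n ` {p. g dvd p}"
  then obtain p where p: "g dvd p" "x = cyclic_class n p" by blast
  let ?r = "p mod (monom 1 n - 1)"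
  have "degree ?r < n"
    using degree_mod_less'[of "monom 1 n - 1" p] monom_minus_one n by fastforce
  then obtain v where v: "v \<in> carrier_vec n" "word_poly v = ?r"
    using bij_betw_word_poly[of n, where 'f='f] n degree_less_iff_coeff[of n ?r]
    by (auto simp: bij_betw_def image_iff set_eq_iff) metis
  have "g dvd ?r" using p g by (simp add: dvd_mod)
  moreover have "cyclic_class n (word_poly v) = x"
    unfolding p(2) cyclic_class_eq_iff v(2)
    by (metis dvd_minus_mod minus_diff_eq dvd_minus_iff)
  ultimately show "x \<in> code_ideal n (multiples_code n g)"
    unfolding code_ideal_def multiples_code_def using v
    by (intro image_eqI[of x _ v]) (simp_all add: word_poly_def)
qed

lemma genideal_cyclic_class:
  "Idl\<^bsub>cyclic_ring n\<^esub> {cyclic_class n g} = cyclic_class n ` {p. g dvd p}"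
proof -
  interpret Q: cring "cyclic_ring n :: 'f poly set ring" by (rule cring_cyclic_ring)
  have "Idl\<^bsub>cyclic_ring n\<^esub> {cyclic_class n g} = PIdl\<^bsub>cyclic_ring n\<^esub> (cyclic_class n g)"
    by (rule Q.cgenideal_eq_genideal[symmetric]) (simp add: carrier_cyclic_ring)
  also have "\<dots> = range (\<lambda>p. cyclic_class n (p * g))"
    unfolding cgenideal_def carrier_cyclic_ring cyclic_class_mult[symmetric] by auto
  also have "\<dots> = cyclic_class n ` range (\<lambda>p. p * g)"
    by (simp add: image_image)
  also have "range (\<lambda>p. p * g) = {p. g dvd p}"
    by (auto simp: dvd_def mult.commute)
  finally show ?thesis .
qed

lemma cyclic_code_multiples_code: "cyclic_code n (multiples_code n g)"
proof -
  interpret Q: cring "cyclic_ring n :: 'f poly set ring" by (rule cring_cyclic_ring)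
  have "ideal (Idl\<^bsub>cyclic_ring n\<^esub> {cyclic_class n g}) (cyclic_ring n)"
    by (rule Q.genideal_ideal) (simp add: carrier_cyclic_ring)
  then show ?thesis
    unfolding cyclic_code_def code_ideal_multiples_code genideal_cyclic_class
    by (auto simp: multiples_code_def)
qed

text \<open>Minimality of the degree: a rival \<open>h\<close> is congruent to a multiple of
  \<open>g\<close> modulo \<open>x^n - 1\<close>, and \<open>g\<close> divides the modulus, so
  \<open>g\<close> divides \<open>h\<close>.\<close>

lemma is_generator_poly_multiples_code:
  assumes "monic g"
  shows "is_generator_poly n (multiples_code n g) g"
  unfolding is_generator_poly_def
proof (intro conjI allI impI)
  show "generates_code n (multiples_code n g) g"
    by (simp add: generates_code_def code_ideal_multiples_code genideal_cyclic_class)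
  fix h assume h: "monic h \<and> generates_code n (multiples_code n g) h"
  interpret Q: cring "cyclic_ring n :: 'f poly set ring" by (rule cring_cyclic_ring)
  have "cyclic_class n h \<in> Idl\<^bsub>cyclic_ring n\<^esub> {cyclic_class n h}"
    using Q.genideal_self[of "{cyclic_class n h}"] by (simp add: carrier_cyclic_ring)
  then have "cyclic_class n h \<in> cyclic_class n ` {p. g dvd p}"
    using h by (simp add: generates_code_def code_ideal_multiples_code)
  then obtain p where p: "g dvd p" "cyclic_class n h = cyclic_class n p"
    by blast
  then have "g dvd h - p"
    using g by (auto simp: cyclic_class_eq_iff intro: dvd_trans)
  then have "g dvd h"
    using p(1) dvd_add[of g "h - p" p] by simp
  moreover have "h \<noteq> 0"
    using conjunct1[OF h] by fastforce
  ultimately show "degree g \<le> degree h"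
    by (rule dvd_imp_degree_le)
qed (fact assms)

text \<open>Uniqueness for \<open>THE\<close>: \<open>g\<close> determines the ideal, and a word of
  length \<open>n\<close> is determined by its class, so the ideal determines the code.\<close>

lemma cyclic_code_of_eq:
  assumes "monic g"
  shows "cyclic_code_of n g = multiples_code n g"
  unfolding cyclic_code_of_def
proof (rule the_equality)
  fix C assume C: "cyclic_code n C \<and> is_generator_poly n C g"
  then have "code_ideal n C = code_ideal n (multiples_code n g)"
    by (simp add: is_generator_poly_def generates_code_def genideal_cyclic_class code_ideal_multiples_code)
  then show "C = multiples_code n g"
    unfolding code_ideal_def
    using inj_on_image_eq_iff[OF inj_on_cyclic_class, of C "multiples_code n g"] C cyclic_code_multiples_code
    by (simp add: cyclic_code_def)
qed (simp add: cyclic_code_multiples_code is_generator_poly_multiples_code[OF assms])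

end
end
end

section \<open>Minimal polynomials over the prime field\<close>

lemma CARD_finite_3: "CARD(Enum.finite_3) = 3"
  by (simp add: UNIV_finite_3 flip: numeral_3_eq_3)

lemma F3_exhaust:
  fixes c :: F3
  obtains "c = 0" | "c = 1" | "c = -1"
proof -
  have "to_int_mod_ring c \<in> {0..<3}"
    using range_to_int_mod_ring[where 'a = Enum.finite_3] by (simp add: CARD_finite_3 set_eq_iff) blast
  then have "to_int_mod_ring c = 0 \<or> to_int_mod_ring c = 1 \<or> to_int_mod_ring c = 2"
    unfolding atLeastLessThan_iff by arith
  moreover have "c = of_int (to_int_mod_ring c)"
    by (simp add: of_int_of_int_mod_ring)
  moreover have "(2 :: F3) = -1"
    using of_nat_card_eq_0[where 'a = Enum.finite_3] by (simp add: CARD_finite_3 eq_neg_iff_add_eq_0)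
  ultimately have "c = 0 \<or> c = 1 \<or> c = -1" by (elim disjE) simp_all
  then show ?thesis using that by blast
qed

lemma CHAR_eq_3:
  assumes "CARD('a::finite_field) = 3 ^ m"
  shows "CHAR('a) = 3"
proof -
  have "CHAR('a) dvd 3 ^ m" using CHAR_dvd_CARD[where 'a = 'a] assms by simp
  then have "CHAR('a) dvd 3" using prime_dvd_power CHAR_prime by blast
  then show ?thesis
    using CHAR_prime[where 'a = 'a] primes_dvd_imp_eq[of "CHAR('a)" 3] by simp
qed

text \<open>\<open>F3_embed\<close> goes through a chosen integer representative, but in
  characteristic 3 only the residue modulo 3 matters. The homomorphism laws are then inherited from
  \<open>of_int\<close>.\<close>

lemma F3_embed_of_int:
  assumes "CHAR('a::field) = 3"
  shows "F3_embed (of_int x) = (of_int x :: 'a)"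
proof -
  have "to_int_mod_ring (of_int x :: F3) = x mod 3"
    by (simp add: of_int_of_int_mod_ring to_int_mod_ring.rep_eq of_int_mod_ring.rep_eq CARD_finite_3)
  then show ?thesis
    by (simp add: F3_embed_def of_int_eq_iff_cong_CHAR assms)
qed

lemma F3_embed_hom:
  assumes "CHAR('a::field) = 3"
  shows "comm_ring_hom (F3_embed :: F3 \<Rightarrow> 'a)"
proof -
  have of_int: "c = of_int (to_int_mod_ring c)" for c :: F3
    by (simp add: of_int_of_int_mod_ring)
  show ?thesis
  proof
    show "F3_embed (0 :: F3) = (0 :: 'a)" "F3_embed (1 :: F3) = (1 :: 'a)"
      using F3_embed_of_int[OF assms, of 0] F3_embed_of_int[OF assms, of 1] by simp_all
    fix c d :: F3
    have "F3_embed (of_int x + of_int y) = (of_int x + of_int y :: 'a)"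
      and "F3_embed (of_int x * of_int y) = (of_int x * of_int y :: 'a)" for x y
      using F3_embed_of_int[OF assms, of "x + y"] F3_embed_of_int[OF assms, of "x * y"] by simp_all
    then show "F3_embed (c + d) = (F3_embed c + F3_embed d :: 'a)"
      and "F3_embed (c * d) = (F3_embed c * F3_embed d :: 'a)"
      using of_int[of c] of_int[of d] F3_embed_of_int[OF assms] by metis+
  qed
qed

text \<open>The value behind \<open>F3_root\<close>, named because evaluation is a ring homomorphism
  whose kernel consists of the polynomials with root \<open>b\<close>.\<close>

definition F3_eval :: "'a::field \<Rightarrow> F3 poly \<Rightarrow> 'a" where
  "F3_eval b p = poly (map_poly F3_embed p) b"

lemma F3_root_iff_eval: "F3_root p b \<longleftrightarrow> F3_eval b p = 0"
  by (simp add: F3_root_def F3_eval_def)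

context
  assumes char: "CHAR('a::finite_field) = 3"
begin

interpretation F3_embed: comm_ring_hom "F3_embed :: F3 \<Rightarrow> 'a"
  by (rule F3_embed_hom[OF char])

interpretation map_poly_comm_ring_hom "F3_embed :: F3 \<Rightarrow> 'a" ..

lemma F3_eval_add: "F3_eval (b::'a) (p + q) = F3_eval b p + F3_eval b q"
  and F3_eval_diff: "F3_eval b (p - q) = F3_eval b p - F3_eval b q"
  and F3_eval_mult: "F3_eval b (p * q) = F3_eval b p * F3_eval b q"
  and F3_eval_0: "F3_eval b 0 = 0"
  and F3_eval_1: "F3_eval b 1 = 1"
  and F3_eval_uminus: "F3_eval b (- p) = - F3_eval b p"
  and F3_eval_monom: "F3_eval b (monom c k) = F3_embed c * b ^ k"
  and F3_eval_smult: "F3_eval b (smult c p) = F3_embed c * F3_eval b p"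
  and F3_eval_pCons: "F3_eval b (pCons c p) = F3_embed c + b * F3_eval b p"
  by (simp_all add: F3_eval_def hom_distribs poly_monom)

lemma F3_embed_simps: "F3_embed 0 = (0::'a)" "F3_embed 1 = (1::'a)" "F3_embed (-1) = (-1::'a)"
  by (simp_all add: hom_distribs)

lemma F3_embed_power_3: "F3_embed c ^ 3 ^ k = (F3_embed c :: 'a)"
  using fermat_theorem_mod_ring2[of c k] by (simp add: CARD_finite_3 flip: F3_embed.hom_power)

text \<open>Powers with exponent \<open>3 ^ k\<close> are additive in characteristic 3 and fix the
  prime field, so they pass through the coefficients to the argument.\<close>

lemma F3_eval_frobenius: "F3_eval (b::'a) p ^ 3 ^ k = F3_eval (b ^ 3 ^ k) p"
proof (induction p)
  case (pCons c p)
  then show ?case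
    by (simp add: F3_eval_pCons freshmans_dream'[OF CHAR_prime] char F3_embed_power_3 power_mult_distrib)
qed (simp add: F3_eval_0)

text \<open>Summing over the support makes the number of terms equal to the Hamming weight, as
  \<open>weight_ge_4\<close> needs.\<close>

lemma F3_eval_support: "F3_eval (b::'a) p = (\<Sum>i | coeff p i \<noteq> 0. F3_embed (coeff p i) * b ^ i)"
proof -
  have "F3_eval b p = F3_eval b (\<Sum>i\<le>degree p. monom (coeff p i) i)"
    by (simp add: poly_as_sum_of_monoms)
  also have "\<dots> = (\<Sum>i\<le>degree p. F3_embed (coeff p i) * b ^ i)"
    using sum_comp_morphism[of "F3_eval b" "\<lambda>i. monom (coeff p i) i" "{..degree p}"]
    by (simp add: o_def F3_eval_monom F3_eval_0 F3_eval_add)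
  also have "\<dots> = (\<Sum>i | coeff p i \<noteq> 0. F3_embed (coeff p i) * b ^ i)"
    by (intro sum.mono_neutral_right) (auto simp: F3_embed_simps intro: le_degree)
  finally show ?thesis .
qed

lemma F3_algebraic: "\<exists>p. p \<noteq> 0 \<and> F3_root p (b::'a)"
proof (intro exI conjI)
  have "CARD('a) > 1"
    using card_mono[of UNIV "{0,1::'a}"] by simp
  then show "monom 1 CARD('a) - monom 1 1 \<noteq> (0 :: F3 poly)"
    by (metis coeff_diff coeff_monom diff_zero eq_iff_diff_eq_0 less_irrefl zero_neq_one)
  show "F3_root (monom 1 CARD('a) - monom 1 1) b"
    using finite_field_power_card_eq_same[of b]
    by (simp add: F3_root_iff_eval F3_eval_diff F3_eval_monom F3_embed_simps)
qed

text \<open>These properties justify the \<open>THE\<close> in \<open>min_poly\<close>. A nonzero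
  polynomial of least degree is made monic for existence. For uniqueness, the difference of two
  candidates loses its leading term but still has the root \<open>b\<close>.\<close>

lemma min_poly_props:
  fixes b :: 'a
  shows "monic (min_poly b)" and "F3_root (min_poly b) b"
    and "q \<noteq> 0 \<Longrightarrow> F3_root q b \<Longrightarrow> degree (min_poly b) \<le> degree q"
proof -
  let ?P = "\<lambda>p. monic p \<and> F3_root p b \<and> (\<forall>q. q \<noteq> 0 \<and> F3_root q b \<longrightarrow> degree p \<le> degree q)"
  obtain p where p: "p \<noteq> 0 \<and> F3_root p b"
    and least: "\<And>q. q \<noteq> 0 \<and> F3_root q b \<Longrightarrow> degree p \<le> degree q"
    using F3_algebraic[of b] ex_has_least_nat[of "\<lambda>p. p \<noteq> 0 \<and> F3_root p b" _ degree] by metis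
  let ?p = "smult (inverse (lead_coeff p)) p"
  have "?P ?p"
    using p least by (simp add: F3_root_iff_eval F3_eval_smult)
  moreover have "p1 = p2" if "?P p1" "?P p2" for p1 p2
  proof (rule ccontr)
    assume "p1 \<noteq> p2"
    have "degree p1 = degree p2"
      using that by (metis le_antisym leading_coeff_0_iff zero_neq_one)
    have "F3_root (p1 - p2) b"
      using that by (simp add: F3_root_iff_eval F3_eval_diff)
    then have "degree p1 \<le> degree (p1 - p2)"
      using that \<open>p1 \<noteq> p2\<close> by simp
    moreover have "degree (p1 - p2) \<le> degree p1"
      using degree_diff_le[of p1 "degree p1" p2] \<open>degree p1 = degree p2\<close> by simp
    moreover have "coeff (p1 - p2) (degree p1) = 0"
      using that \<open>degree p1 = degree p2\<close> by simp
    ultimately show False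
      using \<open>p1 \<noteq> p2\<close> by (metis le_antisym leading_coeff_0_iff right_minus_eq)
  qed
  ultimately have "\<exists>!p. ?P p" by blast
  then have "?P (min_poly b)"
    unfolding min_poly_def by (rule theI')
  then show "monic (min_poly b)" "F3_root (min_poly b) b"
    "q \<noteq> 0 \<Longrightarrow> F3_root q b \<Longrightarrow> degree (min_poly b) \<le> degree q"
    by blast+
qed

lemma min_poly_nonzero: "min_poly (b::'a) \<noteq> 0"
  using min_poly_props(1)[of b] by force

lemma F3_eval_mod_min_poly: "F3_eval (b::'a) (p mod min_poly b) = F3_eval b p"
proof -
  have "F3_eval b p = F3_eval b (p div min_poly b * min_poly b + p mod min_poly b)"
    by simp
  also have "\<dots> = F3_eval b (p mod min_poly b)"
    unfolding F3_eval_add F3_eval_mult using min_poly_props(2)[of b] by (simp add: F3_root_iff_eval)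
  finally show ?thesis by simp
qed

lemma min_poly_dvd_iff: "min_poly (b::'a) dvd p \<longleftrightarrow> F3_root p b"
proof
  assume "min_poly b dvd p"
  then show "F3_root p b"
    using min_poly_props(2)[of b] by (auto simp: dvd_def F3_root_iff_eval F3_eval_mult)
next
  assume "F3_root p b"
  then have "F3_root (p mod min_poly b) b"
    by (simp add: F3_root_iff_eval F3_eval_mod_min_poly)
  then have "p mod min_poly b = 0"
    using min_poly_props(3)[of "p mod min_poly b" b] degree_mod_less[OF min_poly_nonzero[of b], of p] by fastforce
  then show "min_poly b dvd p" by (simp add: dvd_eq_mod_eq_0)
qed

lemma degree_min_poly_pos: "degree (min_poly (b::'a)) > 0"
proof (rule ccontr)
  assume "\<not> ?thesis"
  then have "min_poly b = 1"
    using min_poly_props(1)[of b] monic_degree_0[of "min_poly b"] by simp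
  then show False
    using min_poly_props(2)[of b] by (simp add: F3_root_iff_eval F3_eval_1)
qed

text \<open>Its multiples form the kernel of a ring homomorphism into a field, where a product
  vanishes only if a factor does.\<close>

lemma prime_elem_min_poly: "prime_elem (min_poly (b::'a))"
proof -
  have "\<not> min_poly b dvd 1"
    unfolding min_poly_dvd_iff F3_root_iff_eval F3_eval_1 by simp
  moreover have "min_poly b dvd p \<or> min_poly b dvd q" if "min_poly b dvd p * q" for p q
    using that by (simp add: min_poly_dvd_iff F3_root_iff_eval F3_eval_mult)
  ultimately show ?thesis unfolding prime_elem_def using min_poly_nonzero by blast
qed

text \<open>A prime element is coprime to whatever it does not divide, and it cannot divide a
  nonzero polynomial of smaller degree.\<close>

lemma coprime_min_poly:
  assumes "degree (min_poly (b::'a)) > degree (min_poly (c::'a))"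
  shows "Rings.coprime (min_poly b) (min_poly c)"
  by (rule prime_elem_imp_coprime[OF prime_elem_min_poly])
    (use assms dvd_imp_degree_le[OF _ min_poly_nonzero, of "min_poly b" c] in auto)

text \<open>The range is the subfield generated by \<open>b\<close>, and the remainders modulo
  \<open>min_poly b\<close> represent each of its elements once. Counting values thus yields the
  degree of a minimal polynomial.\<close>

lemma card_range_F3_eval: "card (range (F3_eval (b::'a))) = 3 ^ degree (min_poly b)"
proof -
  let ?d = "degree (min_poly b)"
  let ?P = "{p :: F3 poly. \<forall>i\<ge>?d. coeff p i = 0}"
  have P: "p \<in> ?P \<longleftrightarrow> degree p < ?d" for p
    using degree_less_iff_coeff[OF degree_min_poly_pos[of b], of p] by simp
  have "range (F3_eval b) = F3_eval b ` ?P"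
  proof (intro equalityI subsetI)
    fix x assume "x \<in> range (F3_eval b)"
    then obtain p where "x = F3_eval b p" by blast
    moreover have "p mod min_poly b \<in> ?P"
      using degree_mod_less[OF min_poly_nonzero[of b], of p] degree_min_poly_pos[of b] unfolding P by fastforce
    ultimately show "x \<in> F3_eval b ` ?P"
      by (intro image_eqI[of x _ "p mod min_poly b"]) (simp_all only: F3_eval_mod_min_poly)
  qed auto
  moreover have "inj_on (F3_eval b) ?P"
  proof (rule inj_onI)
    fix p q assume pq: "p \<in> ?P" "q \<in> ?P" "F3_eval b p = F3_eval b q"
    then have "p - q \<in> ?P" by simp
    then have "degree (p - q) < ?d" by (simp only: P)
    moreover have "F3_root (p - q) b"
      using pq by (simp add: F3_root_iff_eval F3_eval_diff)
    ultimately show "p = q"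
      using min_poly_props(3)[of "p - q" b] by fastforce
  qed
  ultimately show ?thesis
    by (simp add: card_image card_polys_coeff_bounded CARD_finite_3)
qed

lemma degree_min_poly_1: "degree (min_poly (1::'a)) = 1"
proof -
  have "F3_root [:-1, 1:] (1::'a)"
    by (simp add: F3_root_iff_eval F3_eval_pCons F3_eval_0 F3_eval_1 F3_embed_simps)
  then have "degree (min_poly (1::'a)) \<le> 1"
    using min_poly_props(3)[of "[:-1, 1:]" "1::'a"] by simp
  then show ?thesis using degree_min_poly_pos[of "1::'a"] by simp
qed

end

section \<open>The norm equation\<close>

text \<open>Integer exponents are reduced modulo the group order, using
  \<open>\<alpha> ^ n = 1\<close>. The remaining exponents are as many as the nonzero elements they
  reach, which forces injectivity.\<close>

lemma mult_generatorD:
  fixes \<alpha> :: "'a::finite_field"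
  assumes "mult_generator \<alpha>"
  shows "\<alpha> \<noteq> 0" and "(\<lambda>k. \<alpha> ^ k) ` {..<CARD('a) - 1} = UNIV - {0}"
    and "inj_on (\<lambda>k. \<alpha> ^ k) {..<CARD('a) - 1}"
proof -
  define n where "n = CARD('a) - 1"
  have range: "range (\<lambda>i::int. \<alpha> powi i) = UNIV - {0}"
    using assms by (simp add: mult_generator_def)
  have "\<alpha> powi 1 \<in> UNIV - {0}" unfolding range[symmetric] by blast
  then show nz: "\<alpha> \<noteq> 0" by simp
  have "CARD('a) > 1"
    using card_mono[of UNIV "{0,1::'a}"] by simp
  then have n: "n > 0" "CARD('a) = Suc n" by (simp_all add: n_def)
  have one: "\<alpha> ^ n = 1"
    using finite_field_power_card_eq_same[of \<alpha>] nz n(2) by simp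
  have "UNIV - {0} \<subseteq> (\<lambda>k. \<alpha> ^ k) ` {..<n}"
  proof
    fix x :: 'a assume "x \<in> UNIV - {0}"
    then obtain i :: int where i: "x = \<alpha> powi i" using range by blast
    have "x = \<alpha> powi (int n * (i div int n) + i mod int n)"
      by (simp add: i)
    also have "\<dots> = (\<alpha> powi int n) powi (i div int n) * \<alpha> powi (i mod int n)"
      by (simp only: power_int_add[OF disjI1[OF nz]] power_int_mult)
    also have "\<dots> = \<alpha> ^ nat (i mod int n)"
      using n one by (simp add: power_int_def)
    finally have "x = \<alpha> ^ nat (i mod int n)" .
    moreover have "nat (i mod int n) < n"
      using n by (simp add: nat_less_iff)
    ultimately show "x \<in> (\<lambda>k. \<alpha> ^ k) ` {..<n}" by blast
  qed
  then show img: "(\<lambda>k. \<alpha> ^ k) ` {..<CARD('a) - 1} = UNIV - {0}"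
    using nz by (auto simp: n_def)
  show "inj_on (\<lambda>k. \<alpha> ^ k) {..<CARD('a) - 1}"
    by (rule eq_card_imp_inj_on, simp, unfold img) (simp add: card_Diff_singleton)
qed

section \<open>Conjugates and the quadratic character\<close>

context
  fixes \<alpha> :: "'a::finite_field" and h e :: nat
  assumes card: "CARD('a) = 3 ^ (2 * h)" and gen: "mult_generator \<alpha>"
    and h: "h > 0" "even h"
    and e: "e = (3 ^ (2 * h) - 1) div 2 + 3 ^ h + 1"
begin

lemma char_3: "CHAR('a) = 3"
  by (rule CHAR_eq_3[OF card])

lemma three_eq_0: "(3::'a) = 0"
  using of_nat_CHAR[where 'a = 'a] by (simp add: char_3)

lemma frobenius_add: "(x + y) ^ 3 ^ h = x ^ 3 ^ h + (y::'a) ^ 3 ^ h"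
  by (rule freshmans_dream'[OF CHAR_prime]) (simp add: char_3)

lemma one_neq_minus_one: "(1::'a) \<noteq> -1"
proof
  assume "(1::'a) = -1"
  then have "(2::'a) = 0" by (simp add: eq_neg_iff_add_eq_0)
  moreover have "(1::'a) = 3 - 2" by simp
  ultimately show False unfolding three_eq_0 by simp
qed

text \<open>For even \<open>h\<close>, \<open>r = 3 ^ h\<close> is a power of 9, so
  \<open>r = 4 * s + 1\<close>. The odd factor is \<open>(r + 1) / 2\<close> in the factorization of
  \<open>r^2 - 1\<close>.\<close>

lemma half_order:
  obtains s where "(3 ^ (2 * h) - 1) div 2 = (3 ^ h - 1) * (2 * s + (1::nat))"
proof -
  obtain j where j: "h = 2 * j" using h by blast
  have "[9 ^ j = 1 ^ j] (mod (4::nat))"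
    by (intro cong_pow) (simp add: cong_def)
  then have "3 ^ h mod 4 = (1::nat)"
    by (simp add: j power_mult cong_def)
  then obtain s where s: "3 ^ h = 4 * s + (1::nat)"
    by (metis mult_div_mod_eq)
  have "(3::nat) ^ (2 * h) = (4 * s + 1) * (4 * s + 1)"
    unfolding s[symmetric] by (simp add: mult_2 power_add)
  then have "(3 ^ (2 * h) - 1) div 2 = (3 ^ h - 1) * (2 * s + (1::nat))"
    unfolding s by (simp add: algebra_simps)
  then show ?thesis by (rule that)
qed

lemma power_half_order:
  assumes "(x::'a) \<noteq> 0"
  shows "x ^ ((3 ^ (2 * h) - 1) div 2) = 1 \<or> x ^ ((3 ^ (2 * h) - 1) div 2) = -1"
proof -
  have "x ^ 3 ^ (2 * h) = x"
    using finite_field_power_card_eq_same[of x] card by simp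
  moreover have "3 ^ (2 * h) = Suc (2 * ((3 ^ (2 * h) - 1) div 2))"
    by (simp add: odd_two_times_div_two_nat)
  ultimately have "x * x ^ (2 * ((3 ^ (2 * h) - 1) div 2)) = x"
    by (metis power_Suc)
  then have "x ^ (2 * ((3 ^ (2 * h) - 1) div 2)) = 1"
    using assms by simp
  then have "(x ^ ((3 ^ (2 * h) - 1) div 2))\<^sup>2 = 1"
    by (simp only: power_mult[symmetric] mult.commute)
  then show ?thesis
    by (simp add: power2_eq_1_iff)
qed

text \<open>Here evenness of \<open>h\<close> enters: it makes \<open>(3^h + 1) / 2\<close> odd.\<close>
lemma trace_zero_nonsquare:
  assumes "(t::'a) \<noteq> 0" and "t ^ 3 ^ h = - t"
  shows "t ^ ((3 ^ (2 * h) - 1) div 2) = -1"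
proof -
  obtain s where s: "(3 ^ (2 * h) - 1) div 2 = (3 ^ h - 1) * (2 * s + (1::nat))"
    using half_order by blast
  have "t * t ^ (3 ^ h - 1) = t ^ 3 ^ h"
    by (simp flip: power_Suc)
  then have "t ^ (3 ^ h - 1) = -1"
    using assms by (metis mult_cancel_left mult_minus1_right)
  moreover have "t ^ ((3 ^ (2 * h) - 1) div 2) = (t ^ (3 ^ h - 1)) ^ (2 * s + 1)"
    unfolding s by (rule power_mult)
  ultimately show ?thesis by simp
qed

lemma power_e: "x ^ e = x ^ ((3 ^ (2 * h) - 1) div 2) * (x ^ 3 ^ h * (x::'a))"
  by (simp add: e power_add mult_ac)

lemma norm_equation_only_1:
  assumes nz: "(u::'a) \<noteq> 0" "v \<noteq> 0" and sum: "u + v + 1 = 0" and sum_e: "u ^ e + v ^ e + 1 = 0"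
  shows "u = 1"
proof -
  let ?c = "(3 ^ (2 * h) - 1) div 2"
  \<comment> \<open>These are the conjugates over the subfield with \<open>3 ^ h\<close> elements,
    so \<open>U * u\<close> is a norm and \<open>U + u\<close> a trace.\<close>
  define U V where "U = u ^ 3 ^ h" and "V = v ^ 3 ^ h"
  have v: "v = - 1 - u" using sum by (simp add: algebra_simps eq_neg_iff_add_eq_0)
  have V: "V = - 1 - U"
    using frobenius_add[of "-1" "- u"] by (simp add: v U_def V_def)
  define A B where "A = u ^ ?c" and "B = v ^ ?c"
  have eq: "A * (U * u) + B * (V * v) + 1 = 0"
    using sum_e by (simp add: power_e U_def V_def A_def B_def)
  consider "A = 1" "B = 1" | "A = 1" "B = -1"
    | "A = -1" "B = 1" | "A = -1" "B = -1"
    using power_half_order[OF nz(1)] power_half_order[OF nz(2)] unfolding A_def B_def by blast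
  then show ?thesis
  proof cases
    case 1
    \<comment> \<open>The left side is the norm of \<open>u - 1\<close>; in characteristic 3 it is
      the negative of the left side of the equation.\<close>
    have "(U - 1) * (u - 1) = 3 * (U * u + 1) - (U * u + V * v + 1)"
      by (simp add: v V algebra_simps)
    also have "\<dots> = 0" using eq 1 by (simp add: three_eq_0)
    finally have "U = 1 \<or> u = 1" by simp
    moreover have "(u - 1) ^ 3 ^ h = U - 1"
      using frobenius_add[of u "-1"] by (simp add: U_def)
    ultimately show ?thesis by auto
  next
    case 2
    \<comment> \<open>With these signs the products \<open>U * u\<close> cancel and only the trace
      of \<open>u\<close> survives.\<close>
    have "U + u = - (A * (U * u) + B * (V * v) + 1)"
      using 2 by (simp add: v V algebra_simps)
    then have "U = - u" using eq by (simp add: eq_neg_iff_add_eq_0)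
    then show ?thesis
      using trace_zero_nonsquare[OF nz(1)] 2 one_neq_minus_one by (simp add: U_def A_def)
  next
    case 3
    have "V + v = - (A * (U * u) + B * (V * v) + 1)"
      using 3 by (simp add: v V algebra_simps)
    then have "V = - v" using eq by (simp add: eq_neg_iff_add_eq_0)
    then show ?thesis
      using trace_zero_nonsquare[OF nz(2)] 3 one_neq_minus_one by (simp add: V_def B_def)
  next
    case 4
    \<comment> \<open>The left side is the norm of \<open>u\<close> times the trace of
      \<open>v / u\<close>.\<close>
    have "V * u + v * U = A * (U * u) + B * (V * v) + 1"
      using 4 by (simp add: v V algebra_simps)
    then have "V * u = - v * U" using eq by (simp add: eq_neg_iff_add_eq_0)
    moreover have "U \<noteq> 0" using nz by (simp add: U_def)
    ultimately have "(v / u) ^ 3 ^ h = - (v / u)"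
      using nz by (simp add: power_divide field_simps flip: U_def V_def)
    then have "(v / u) ^ ?c = -1"
      using nz by (intro trace_zero_nonsquare) simp_all
    moreover have "(v / u) ^ ?c = 1"
      using 4 by (simp add: power_divide A_def B_def)
    ultimately show ?thesis using one_neq_minus_one by simp
  qed
qed


text \<open>Both equations are homogeneous, so division by \<open>z\<close> and by
  \<open>z ^ e\<close> normalizes the last term to 1.\<close>

lemma three_term_equal:
  assumes nz: "(x::'a) \<noteq> 0" "y \<noteq> 0" "z \<noteq> 0"
    and "x + y + z = 0" and "x ^ e + y ^ e + z ^ e = 0"
  shows "x = z"
proof -
  have "x / z + y / z + 1 = (x + y + z) / z"
    using nz by (simp add: field_simps)
  moreover have "(x / z) ^ e + (y / z) ^ e + 1 = (x ^ e + y ^ e + z ^ e) / z ^ e"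
    using nz by (simp add: field_simps)
  ultimately have "x / z = 1"
    using assms by (intro norm_equation_only_1[of "x / z" "y / z"]) simp_all
  then show ?thesis using nz by simp
qed

text \<open>The root 1 excludes weight 1, the roots 1 and \<alpha> exclude weight 2, and all three
  roots exclude weight 3. The degree bound keeps the powers of \<alpha> over the support
  distinct.\<close>

lemma weight_ge_4:
  assumes "p \<noteq> 0" and deg: "degree p < CARD('a) - 1"
    and roots: "F3_root p (1::'a)" "F3_root p \<alpha>" "F3_root p (\<alpha> ^ e)"
  shows "4 \<le> card {i. coeff p i \<noteq> 0}"
proof (rule ccontr)
  define S where "S = {i. coeff p i \<noteq> 0}"
  define c where "c i = (F3_embed (coeff p i) :: 'a)" for i
  assume "\<not> ?thesis"
  then have small: "card S \<le> 3" by (simp add: S_def)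
  have S: "S \<subseteq> {..<CARD('a) - 1}"
    using deg le_degree[of p] by (force simp: S_def)
  then have fin: "finite S" by (rule finite_subset) simp
  have "degree p \<in> S" using assms(1) by (simp add: S_def)
  then have "card S \<noteq> 0" using fin by auto
  have c: "c i = 1 \<or> c i = -1" if "i \<in> S" for i
    using that F3_embed_simps[OF char_3] by (cases rule: F3_exhaust[of "coeff p i"]) (auto simp: S_def c_def)
  have c0: "c i \<noteq> 0" if "i \<in> S" for i
    using c[OF that] by auto
  have dist: "\<alpha> ^ i \<noteq> \<alpha> ^ j" if "i \<in> S" "j \<in> S" "i \<noteq> j" for i j
    using inj_onD[OF mult_generatorD(3)[OF gen], of i j] that S by blast
  have pow: "(\<alpha> ^ e) ^ i = (\<alpha> ^ i) ^ e" for i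
    by (simp flip: power_mult add: mult.commute)
  have sums: "(\<Sum>i\<in>S. c i) = 0" "(\<Sum>i\<in>S. c i * \<alpha> ^ i) = 0" "(\<Sum>i\<in>S. c i * (\<alpha> ^ i) ^ e) = 0"
    using roots by (simp_all add: F3_root_iff_eval F3_eval_support[OF char_3] S_def c_def pow)
  have "card S = 1 \<or> card S = 2 \<or> card S = 3"
    using small \<open>card S \<noteq> 0\<close> by linarith
  then show False
  proof (elim disjE)
    assume "card S = 1"
    then obtain i where "S = {i}" by (auto simp: card_1_singleton_iff)
    then show False using sums(1) c0[of i] by simp
  next
    assume "card S = 2"
    then obtain i j where ij: "S = {i, j}" "i \<noteq> j" by (auto simp: card_2_iff)
    then have "c j = - c i" "c i * \<alpha> ^ i + c j * \<alpha> ^ j = 0"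
      using sums by (simp_all add: eq_neg_iff_add_eq_0 add.commute)
    then have "c i * (\<alpha> ^ i - \<alpha> ^ j) = 0" by (simp add: algebra_simps)
    then show False using dist[of i j] c0[of i] ij by simp
  next
    assume "card S = 3"
    then obtain i j k where ijk: "S = {i, j, k}" "i \<noteq> j" "i \<noteq> k" "j \<noteq> k"
      by (auto simp: card_3_iff)
    then have sum1: "c i + (c j + c k) = 0" using sums(1) by simp
    have "c j = c i \<and> c k = c i"
    proof (rule ccontr)
      assume "\<not> ?thesis"
      \<comment> \<open>If the signs are not all equal, two of them cancel and a single sign
        remains.\<close>
      then have "c i + (c j + c k) = 1 \<or> c i + (c j + c k) = -1"
        using c[of i] c[of j] c[of k] ijk by auto
      then show False using sum1 by auto
    qed
    then have "c i * (\<alpha> ^ i + \<alpha> ^ j + \<alpha> ^ k) = 0"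
      and "c i * ((\<alpha> ^ i) ^ e + (\<alpha> ^ j) ^ e + (\<alpha> ^ k) ^ e) = 0"
      using sums ijk by (simp_all add: algebra_simps)
    then have "\<alpha> ^ i = \<alpha> ^ k"
      using three_term_equal[of "\<alpha> ^ i" "\<alpha> ^ j" "\<alpha> ^ k"] mult_generatorD(1)[OF gen] c0[of i] ijk
      by simp
    then show False using dist[of i k] ijk by simp
  qed
qed

section \<open>Degrees of the minimal polynomials of \<alpha> and of its power\<close>

lemma degree_min_poly_generator: "degree (min_poly \<alpha>) = 2 * h"
proof -
  have "x \<in> range (F3_eval \<alpha>)" for x
  proof (cases "x = 0")
    case True
    then show ?thesis by (metis F3_eval_0[OF char_3] rangeI)
  next
    case False
    then obtain k where "x = \<alpha> ^ k" using mult_generatorD(2)[OF gen] by blast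
    then have "x = F3_eval \<alpha> (monom 1 k)"
      by (simp add: F3_eval_monom[OF char_3] F3_embed_simps[OF char_3])
    then show ?thesis by blast
  qed
  \<comment> \<open>Powers of \<alpha> are values of monomials, so \<alpha> generates the whole
    field over its prime field.\<close>
  then have "range (F3_eval \<alpha>) = UNIV" by blast
  then have "(3::nat) ^ degree (min_poly \<alpha>) = 3 ^ (2 * h)"
    using card_range_F3_eval[OF char_3, of \<alpha>] card by simp
  then show ?thesis by simp
qed

text \<open>The exponent lies strictly between 0 and the order of \<alpha>, so the value 1 is
  excluded.\<close>

lemma generator_half_order: "\<alpha> ^ ((3 ^ (2 * h) - 1) div 2) = -1"
proof -
  let ?c = "(3 ^ (2 * h) - 1) div 2 :: nat"
  have "(3::nat) ^ 1 \<le> 3 ^ (2 * h)" using h by (intro power_increasing) simp_all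
  then have "0 < ?c" "?c < 3 ^ (2 * h) - 1" by simp_all
  then have "?c \<in> {..<CARD('a) - 1}" "0 \<in> {..<CARD('a) - 1}"
    unfolding card by (auto simp only: lessThan_iff)
  then have "\<alpha> ^ ?c \<noteq> \<alpha> ^ 0"
    using inj_onD[OF mult_generatorD(3)[OF gen], of ?c 0] \<open>0 < ?c\<close> by fastforce
  then show ?thesis
    using power_half_order[OF mult_generatorD(1)[OF gen]] by simp
qed

lemma generator_power_e: "\<alpha> ^ e = - (\<alpha> ^ (3 ^ h + 1))"
  unfolding power_e generator_half_order by simp

text \<open>The values of polynomials at \<open>\<alpha>^e\<close> form the subfield with \<open>3^h\<close> elements: it contains
  the powers of the norm \<open>\<alpha>^(3^h+1)\<close> and its elements are roots of \<open>x^(3^h) - x\<close>.\<close>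
lemma degree_min_poly_power_e: "degree (min_poly (\<alpha> ^ e)) = h"
proof -
  define r where "r = (3::nat) ^ h"
  define \<gamma> where "\<gamma> = \<alpha> ^ (r + 1)"
  have r: "r > 1" unfolding r_def using h by (intro one_less_power) simp_all
  have rr: "CARD('a) = r * r" by (simp add: card r_def mult_2 power_add)
  have beta: "\<alpha> ^ e = - \<gamma>" by (simp only: generator_power_e \<gamma>_def r_def)
  \<comment> \<open>The exponent \<open>(r + 1) * r\<close> equals \<open>CARD('a) + r\<close>, and
    the power with exponent \<open>CARD('a)\<close> is the identity.\<close>
  have "\<gamma> ^ r = \<alpha> ^ CARD('a) * \<alpha> ^ r"
    by (simp only: \<gamma>_def rr flip: power_mult power_add) (simp add: algebra_simps)
  then have "\<gamma> ^ r = \<gamma>"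
    by (simp add: finite_field_power_card_eq_same \<gamma>_def)
  \<comment> \<open>As \<open>r\<close> is odd, \<open>- \<gamma>\<close> is fixed by the power
    \<open>r\<close> along with \<gamma>, and so are all polynomial values there.\<close>
  then have fixed: "F3_eval (\<alpha> ^ e) p ^ r = F3_eval (\<alpha> ^ e) p" for p
    unfolding beta r_def F3_eval_frobenius[OF char_3] by simp
  have "card (range (F3_eval (\<alpha> ^ e))) \<le> card {x::'a. poly (monom 1 r - monom 1 1) x = 0}"
    using fixed by (intro card_mono) (auto simp: poly_monom)
  also have "\<dots> \<le> degree (monom 1 r - monom 1 1 :: 'a poly)"
  proof (rule card_poly_roots_bound)
    have "coeff (monom 1 r - monom 1 1 :: 'a poly) r = 1" using r by simp
    then show "monom 1 r - monom 1 1 \<noteq> (0 :: 'a poly)" by (metis coeff_0 zero_neq_one)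
  qed
  also have "\<dots> \<le> r"
    using r by (intro degree_diff_le) (simp_all add: degree_monom_le degree_monom_eq)
  finally have le: "card (range (F3_eval (\<alpha> ^ e))) \<le> r" .
  \<comment> \<open>The exponents \<open>(r + 1) * i\<close> stay below \<open>r * r - 1\<close>,
    the order of \<alpha>. With 0 added, these powers give \<open>r\<close> values.\<close>
  have "inj_on (\<lambda>i. \<gamma> ^ i) {..<r - 1}"
  proof (rule inj_onI)
    fix i j assume ij: "i \<in> {..<r - 1}" "j \<in> {..<r - 1}" "\<gamma> ^ i = \<gamma> ^ j"
    have "(r + 1) * k < CARD('a) - 1" if "k < r - 1" for k
    proof -
      have "(r + 1) * k < (r + 1) * (r - 1)" using that by (intro mult_strict_left_mono) simp_all
      also have "\<dots> = CARD('a) - 1" using r by (simp add: rr algebra_simps)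
      finally show ?thesis .
    qed
    moreover have "\<alpha> ^ ((r + 1) * i) = \<alpha> ^ ((r + 1) * j)"
      using ij(3) by (simp only: \<gamma>_def power_mult)
    ultimately have "(r + 1) * i = (r + 1) * j"
      using ij(1,2) by (intro inj_onD[OF mult_generatorD(3)[OF gen]]) (simp_all only: lessThan_iff)
    then show "i = j" unfolding mult_cancel1 by simp
  qed
  then have "card ((\<lambda>i. \<gamma> ^ i) ` {..<r - 1}) = r - 1" by (simp add: card_image)
  moreover have "0 \<notin> (\<lambda>i. \<gamma> ^ i) ` {..<r - 1}"
    using mult_generatorD(1)[OF gen] by (auto simp: \<gamma>_def)
  ultimately have "card (insert 0 ((\<lambda>i. \<gamma> ^ i) ` {..<r - 1})) = r"
    using r by simp
  moreover have "insert 0 ((\<lambda>i. \<gamma> ^ i) ` {..<r - 1}) \<subseteq> range (F3_eval (\<alpha> ^ e))"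
  proof -
    \<comment> \<open>The evaluation point is \<open>- \<gamma>\<close>, so odd powers need a change
      of sign.\<close>
    have "\<gamma> ^ i = F3_eval (\<alpha> ^ e) (if even i then monom 1 i else - monom 1 i)" for i
      by (simp add: beta F3_eval_monom[OF char_3] F3_eval_uminus[OF char_3] F3_embed_simps[OF char_3])
    moreover have "0 = F3_eval (\<alpha> ^ e) 0" by (simp add: F3_eval_0[OF char_3])
    ultimately show ?thesis by blast
  qed
  ultimately have "r \<le> card (range (F3_eval (\<alpha> ^ e)))"
    using card_mono[of "range (F3_eval (\<alpha> ^ e))" "insert 0 ((\<lambda>i. \<gamma> ^ i) ` {..<r - 1})"] by simp
  with le have "3 ^ degree (min_poly (\<alpha> ^ e)) = (3::nat) ^ h"
    by (simp add: card_range_F3_eval[OF char_3] r_def)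
  then show ?thesis by simp
qed

end

section \<open>Assembling the parameters and optimality\<close>

lemma F3_root_monom_minus_1:
  fixes b :: "'a::finite_field"
  assumes "CHAR('a) = 3" and "b \<noteq> 0"
  shows "F3_root (monom 1 (CARD('a) - 1) - 1) b"
proof -
  have "b * b ^ (CARD('a) - 1) = b"
    using finite_field_power_card_eq_same[of b] finite_UNIV_card_ge_0[where 'a = 'a]
    by (metis One_nat_def Suc_pred finite power_Suc)
  then have "b ^ (CARD('a) - 1) = 1" using assms(2) by simp
  then show ?thesis
    using assms(1) by (simp add: F3_root_iff_eval F3_eval_diff F3_eval_1 F3_eval_monom F3_embed_simps)
qed

text \<open>With \<open>r = 3 ^ h\<close> a cubic in \<open>r\<close> is compared with a quartic.
  Writing \<open>r = 9 + t\<close> reduces this to comparing coefficients of polynomials in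
  \<open>t\<close>.\<close>

lemma power_lt_choose_2:
  assumes "h \<ge> 2"
  shows "3 ^ (3 * h + 1) < (3 ^ (2 * h) - 1) choose (2::nat)"
proof -
  define r where "r = (3::nat) ^ h"
  have "(3::nat) ^ 2 \<le> r" unfolding r_def using assms by (intro power_increasing) simp_all
  then obtain t where t: "r = 9 + t" by (auto simp: le_iff_add)
  have r2: "3 ^ (2 * h) = r * r" by (simp add: r_def mult_2 power_add)
  have r3: "3 ^ (3 * h + 1) = 3 * (r * r * r)" by (simp add: r_def power_add power_mult power3_eq_cube mult.commute[of 3 h])
  \<comment> \<open>The extra 2 leaves a strict inequality after the halving in
    \<open>choose_two\<close>.\<close>
  have "2 * (3 * (r * r * r)) + 2 \<le> (r * r - 1) * (r * r - 1 - 1)"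
    by (simp add: t algebra_simps)
  then show ?thesis unfolding r2 r3 choose_two by simp
qed

theorem theorem2:
  fixes \<alpha> :: "'a::finite_field" and m e :: nat
  assumes "CARD('a) = 3 ^ m"
    and "mult_generator \<alpha>"
    and "m \<ge> 4"
    and "[m = 0] (mod 4)"
    and "e = (3 ^ m - 1) div 2 + 3 ^ (m div 2) + 1"
  shows "cyclic_code (3 ^ m - 1) (ternary_code m \<alpha> [0, 1, int e]) \<and>
         optimal_code (3 ^ m - 1) (3 ^ m - (3 * m) div 2 - 2) 4 (ternary_code m \<alpha> [0, 1, int e])"
proof -
  define h where "h = m div 2"
  have "4 dvd m" using assms(4) by (simp add: cong_0_iff)
  then have m: "m = 2 * h" and h: "h \<ge> 2" "h > 0" "even h"
    using assms(3) by (auto simp: h_def elim!: dvdE)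
  have card: "CARD('a) = 3 ^ (2 * h)" and e: "e = (3 ^ (2 * h) - 1) div 2 + 3 ^ h + 1"
    using assms(1,5) by (simp_all add: m)
  have char: "CHAR('a) = 3" by (rule CHAR_eq_3[OF card])
  define n where "n = (3::nat) ^ m - 1"
  \<comment> \<open>The factors are grouped as the list product unfolds for the exponents 0, 1 and
    \<open>e\<close>.\<close>
  define g where "g = min_poly (1::'a) * (min_poly \<alpha> * min_poly (\<alpha> ^ e))"
  have nz: "\<alpha> \<noteq> 0" using mult_generatorD(1)[OF assms(2)] .
  note context_assms = card assms(2) h(2,3) e
  have deg: "degree (min_poly (1::'a)) = 1" "degree (min_poly \<alpha>) = 2 * h" "degree (min_poly (\<alpha> ^ e)) = h"
    by (fact degree_min_poly_1[OF char] degree_min_poly_generator[OF context_assms]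
        degree_min_poly_power_e[OF context_assms])+
  have g_dvd_iff: "g dvd p \<longleftrightarrow> F3_root p (1::'a) \<and> F3_root p \<alpha> \<and> F3_root p (\<alpha> ^ e)" for p
  proof
    assume "g dvd p"
    then have "min_poly (1::'a) dvd p" "min_poly \<alpha> dvd p" "min_poly (\<alpha> ^ e) dvd p"
      unfolding g_def by (meson dvd_mult_left dvd_mult_right)+
    then show "F3_root p (1::'a) \<and> F3_root p \<alpha> \<and> F3_root p (\<alpha> ^ e)"
      by (simp add: min_poly_dvd_iff[OF char])
  next
    assume *: "F3_root p (1::'a) \<and> F3_root p \<alpha> \<and> F3_root p (\<alpha> ^ e)"
    \<comment> \<open>The degrees \<open>2 * h\<close>, \<open>h\<close> and 1 are distinct because
      \<open>h\<close> is at least 2.\<close>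
    have "Rings.coprime (min_poly \<alpha>) (min_poly (\<alpha> ^ e))" "Rings.coprime (min_poly \<alpha>) (min_poly (1::'a))"
      "Rings.coprime (min_poly (\<alpha> ^ e)) (min_poly (1::'a))"
      using h(1) by (auto intro!: coprime_min_poly[OF char] simp: deg)
    then show "g dvd p"
      unfolding g_def using *
      by (intro divides_mult) (simp_all add: min_poly_dvd_iff[OF char] ac_simps)
  qed
  have "monic g"
    by (simp only: g_def lead_coeff_mult min_poly_props(1)[OF char]) simp
  have "g \<noteq> 0" and deg_g: "degree g = 3 * h + 1"
    using min_poly_nonzero[OF char] by (simp_all add: g_def degree_mult_eq deg)
  have n: "n = CARD('a) - 1" by (simp add: n_def assms(1))
  have g_dvd: "g dvd monom 1 n - 1"
    unfolding g_dvd_iff n using F3_root_monom_minus_1[OF char] nz by simp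
  have choose: "3 ^ (3 * h + 1) < n choose 2"
    using power_lt_choose_2[OF h(1)] by (simp add: n_def m)
  \<comment> \<open>This keeps the natural-number subtractions in the dimension from truncating and
    makes the dimension positive.\<close>
  have "3 * h + 2 < (3::nat) ^ m"
  proof -
    have "(3::nat) ^ 2 \<le> 3 ^ h" using h(1) by (intro power_increasing) simp_all
    moreover have "h < 3 ^ h" by (rule power_gt_expt) simp
    moreover have "(9::nat) * 3 ^ h \<le> 3 ^ h * 3 ^ h"
      using calculation(1) by (intro mult_right_mono) simp_all
    ultimately show ?thesis unfolding m mult_2 power_add by linarith
  qed
  then have "n > 0" and k: "3 ^ m - (3 * m) div 2 - 2 = n - degree g" "n - degree g > 0"
    by (simp_all add: n_def deg_g m)
  have code: "ternary_code m \<alpha> [0, 1, int e] = multiples_code n g"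
    using cyclic_code_of_eq[OF \<open>n > 0\<close> g_dvd \<open>monic g\<close>]
    by (simp add: ternary_code_def g_def n_def)
  have "optimal_code n (n - degree g) 4 (multiples_code n g)"
  proof (rule optimal_codeI)
    show "card (multiples_code n g) = CARD(F3) ^ (n - degree g)"
      using \<open>g \<noteq> 0\<close> k(2) by (intro card_multiples_code) simp_all
    \<comment> \<open>Cancelling \<open>3 ^ (n - degree g)\<close> leaves the inequality
      \<open>choose\<close> for the redundancy \<open>3 * h + 1\<close>.\<close>
    have "n - degree g + (3 * h + 1) = n" using k(2) deg_g by simp
    then have "(3::nat) ^ n = 3 ^ (n - degree g) * 3 ^ (3 * h + 1)"
      by (simp only: power_add[symmetric])
    then show "CARD(F3) ^ n < CARD(F3) ^ (n - degree g) * (n choose 2)"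
      using choose by (simp add: CARD_finite_3)
  next
    fix u v assume uv: "u \<in> multiples_code n g" "v \<in> multiples_code n g" "u \<noteq> v"
    \<comment> \<open>By linearity the distance of two words is the weight of their
      difference.\<close>
    define p where "p = word_poly u - word_poly v"
    have dims: "u \<in> carrier_vec n" "v \<in> carrier_vec n"
      using uv by (simp_all add: multiples_code_def)
    then have "degree p < n"
      by (subst degree_less_iff_coeff[OF \<open>n > 0\<close>]) (auto simp: p_def coeff_word_poly)
    moreover have "p \<noteq> 0"
      using dims uv(3) bij_betw_word_poly[of n, where 'f = F3] by (auto simp: p_def bij_betw_def inj_on_def)
    moreover have "g dvd p"
      using uv by (auto simp: p_def multiples_code_def)
    ultimately have "4 \<le> card {i. coeff p i \<noteq> 0}"
      using weight_ge_4[OF context_assms] by (simp add: g_dvd_iff n)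
    also have "{i. coeff p i \<noteq> 0} = {i. i < dim_vec u \<and> u $ i \<noteq> v $ i}"
      using dims by (auto simp: p_def coeff_word_poly)
    finally show "4 \<le> hamming_dist u v"
      by (simp add: hamming_dist_def)
  qed (fact subspace_multiples_code k(2))+
  moreover have "cyclic_code n (multiples_code n g)"
    using cyclic_code_multiples_code[OF \<open>n > 0\<close> g_dvd] .
  ultimately show ?thesis
    unfolding code k(1) by (simp add: n_def)
qed

end
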